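(* Let $(X_k)_{k\ge1}$ be a stationary ergodic sequence of $\mathbb{R}^d$-valued random variables with $\Vert X_k\Vert\le A$ almost surely for all $k$, satisfying the Devroye inequality. Let $\eta\in(0,1]$ and let $D=D(\eta)$ be the constant in the Devroye inequality. There exists a positive constant $\Gamma$ such that for every $\eta$-Hölder continuous function $u:\mathbb{R}^d\to\mathbb{R}$ (with Hölder constant $L_u$) whose auto-covariance function $C(\ell)=C_u(\ell)$ satisfies $\sum_{\ell=1}^\infty |C(\ell)|/\ell<\infty$, and for every integer $n\ge1$, $$\mathbb{E}\Big(\Big(\sup_{\omega\in[0,2\pi]}\big|\tilde J_n(\omega)-J(\omega)\big|\Big)^2\Big)\le \Gamma\,\inf_{N\ge1}\left\{N\left[\frac{C(1)^2+D\,A^{2\eta}L_u^4(1+\log n)^2}{n}+\Delta_n^2\right]+\left[\frac{C(1)}{N}+\Delta_N\right]^2\right\},$$ where the infimum is over integers $N$.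
   Context: The random variables are defined on a probability space with expectation $\mathbb{E}$, and $A>0$ is a constant. For $\eta\in(0,1]$, a function $K:(\mathbb{R}^d)^n\to\mathbb{R}$ is separately $\eta$-Hölder if for every $1\le j\le n$ $$L_j(K)=\sup_{x_1,\ldots,x_n}\ \sup_{\tilde x_j\ne x_j}\frac{|K(x_1,\ldots,x_j,\ldots,x_n)-K(x_1,\ldots,\tilde x_j,\ldots,x_n)|}{\Vert x_j-\tilde x_j\Vert^\eta}<\infty .$$ The process satisfies the Devroye inequality if for every $\eta\in(0,1]$ there is a constant $D=D(\eta)>0$ such that for every integer $n\ge1$ and every real-valued separately $\eta$-Hölder function $K$ on $(\mathbb{R}^d)^n$, $\mathrm{var}(K(X_1,\ldots,X_n))\le D\sum_{j=1}^n L_j(K)^2$. Auto-covariance: $C(\ell)=C_u(\ell)=\mathbb{E}(u(X_1)u(X_\ell))-(\mathbb{E}(u(X_1)))^2$, $\ell\ge1$ (so $C(1)$ is the variance of $u(X_1)$). Empirical spectral distribution function of order $n$: $$\tilde J_n(\omega)=\int_0^\omega\frac1n\Big|\sum_{j=1}^n e^{-ijs}\Big(u(X_j)-\frac1n\sum_{\ell=1}^n u(X_\ell)\Big)\Big|^2ds .$$ Limit function: $J(\omega)=C(1)\,\omega+2\sum_{k=1}^\infty\frac{\sin(\omega k)}{k}\,C(k+1)$. For $n\ge 1$: $\Delta_n=\frac2n\sum_{k=1}^{n-1}|C(k+1)|+2\sum_{k=n}^\infty\frac{|C(k+1)|}{k}$. *)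

theory Defs
  imports "HOL-Probability.Probability"
begin

text \<open>A process \<open>(X\<^sub>k)\<close>, \<open>k \<ge> 1\<close>, is a function on \<open>nat\<close> whose value at \<open>0\<close> is never used.
  The next five definitions view it through its law on the sequence space \<open>(R\<^sup>d)\<^bsup>{1,2,...}\<^esup>\<close>.\<close>

definition seq_space :: "(nat \<Rightarrow> real ^ 'd) measure" where
  "seq_space = (\<Pi>\<^sub>M k\<in>{1..}. borel)"

definition path_law :: "'a measure \<Rightarrow> (nat \<Rightarrow> 'a \<Rightarrow> real ^ 'd) \<Rightarrow> (nat \<Rightarrow> real ^ 'd) measure" where
  "path_law M X = distr M seq_space (\<lambda>x. \<lambda>k\<in>{1..}. X k x)"

definition shift :: "(nat \<Rightarrow> real ^ 'd) \<Rightarrow> (nat \<Rightarrow> real ^ 'd)" where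
  "shift x = (\<lambda>k\<in>{1..}. x (k + 1))"

definition stationary :: "'a measure \<Rightarrow> (nat \<Rightarrow> 'a \<Rightarrow> real ^ 'd) \<Rightarrow> bool" where
  "stationary M X \<longleftrightarrow> distr (path_law M X) seq_space shift = path_law M X"

definition ergodic :: "'a measure \<Rightarrow> (nat \<Rightarrow> 'a \<Rightarrow> real ^ 'd) \<Rightarrow> bool" where
  "ergodic M X \<longleftrightarrow>
     (\<forall>B\<in>sets seq_space. shift -` B \<inter> space seq_space = B \<longrightarrow> measure (path_law M X) B \<in> {0, 1})"

text \<open>Points of \<open>(R\<^sup>d)\<^sup>n\<close> are the functions in \<open>{1..n} \<rightarrow>\<^sub>E UNIV\<close>; only the values of \<open>K\<close> on this set
  matter. The finiteness of the supremum \<open>L\<^sub>j(K)\<close> is expressed by \<open>bdd_above\<close>, so that the real-valued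
  \<open>Sup\<close> is the genuine supremum for separately Hoelder functions.\<close>

definition sep_quotients ::
    "real \<Rightarrow> nat \<Rightarrow> ((nat \<Rightarrow> real ^ 'd) \<Rightarrow> real) \<Rightarrow> nat \<Rightarrow> real set" where
  "sep_quotients \<eta> n K j =
     {\<bar>K x - K (x(j := y))\<bar> / norm (x j - y) powr \<eta> | x y. x \<in> {1..n} \<rightarrow>\<^sub>E UNIV \<and> y \<noteq> x j}"

definition sep_hoelder :: "real \<Rightarrow> nat \<Rightarrow> ((nat \<Rightarrow> real ^ 'd) \<Rightarrow> real) \<Rightarrow> bool" where
  "sep_hoelder \<eta> n K \<longleftrightarrow> (\<forall>j\<in>{1..n}. bdd_above (sep_quotients \<eta> n K j))"

definition sep_const ::
    "real \<Rightarrow> nat \<Rightarrow> ((nat \<Rightarrow> real ^ 'd) \<Rightarrow> real) \<Rightarrow> nat \<Rightarrow> real" where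
  "sep_const \<eta> n K j = Sup (sep_quotients \<eta> n K j)"

definition devroye_const ::
    "'a measure \<Rightarrow> (nat \<Rightarrow> 'a \<Rightarrow> real ^ 'd) \<Rightarrow> real \<Rightarrow> real \<Rightarrow> bool" where
  "devroye_const M X \<eta> D \<longleftrightarrow> D > 0 \<and>
     (\<forall>n\<ge>1. \<forall>K. sep_hoelder \<eta> n K \<longrightarrow>
        prob_space.variance M (\<lambda>x. K (\<lambda>j\<in>{1..n}. X j x)) \<le> D * (\<Sum>j=1..n. (sep_const \<eta> n K j)\<^sup>2))"

definition devroye_inequality :: "'a measure \<Rightarrow> (nat \<Rightarrow> 'a \<Rightarrow> real ^ 'd) \<Rightarrow> bool" where
  "devroye_inequality M X \<longleftrightarrow> (\<forall>\<eta>\<in>{0<..1}. \<exists>D. devroye_const M X \<eta> D)"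

definition hoelder_quotients :: "real \<Rightarrow> (real ^ 'd \<Rightarrow> real) \<Rightarrow> real set" where
  "hoelder_quotients \<eta> u = {\<bar>u x - u y\<bar> / norm (x - y) powr \<eta> | x y. x \<noteq> y}"

definition hoelder :: "real \<Rightarrow> (real ^ 'd \<Rightarrow> real) \<Rightarrow> bool" where
  "hoelder \<eta> u \<longleftrightarrow> bdd_above (hoelder_quotients \<eta> u)"

definition hoelder_const :: "real \<Rightarrow> (real ^ 'd \<Rightarrow> real) \<Rightarrow> real" where
  "hoelder_const \<eta> u = Sup (hoelder_quotients \<eta> u)"

definition autocov ::
    "'a measure \<Rightarrow> (nat \<Rightarrow> 'a \<Rightarrow> real ^ 'd) \<Rightarrow> (real ^ 'd \<Rightarrow> real) \<Rightarrow> nat \<Rightarrow> real" where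
  "autocov M X u l =
     prob_space.expectation M (\<lambda>x. u (X 1 x) * u (X l x)) - (prob_space.expectation M (\<lambda>x. u (X 1 x)))\<^sup>2"

definition emp_spectral ::
    "(nat \<Rightarrow> 'a \<Rightarrow> real ^ 'd) \<Rightarrow> (real ^ 'd \<Rightarrow> real) \<Rightarrow> nat \<Rightarrow> 'a \<Rightarrow> real \<Rightarrow> real" where
  "emp_spectral X u n x \<omega> =
     integral {0..\<omega>} (\<lambda>s. 1 / real n *
       (cmod (\<Sum>j=1..n. exp (- (\<i> * of_nat j * of_real s)) *
          of_real (u (X j x) - 1 / real n * (\<Sum>l=1..n. u (X l x)))))\<^sup>2)"

text \<open>In the infinite series below the summation index starts at \<open>0\<close>: the series over \<open>k \<ge> n\<close> is
  written with \<open>k + n\<close> in place of \<open>k\<close>.\<close>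

definition spectral :: "(nat \<Rightarrow> real) \<Rightarrow> real \<Rightarrow> real" where
  "spectral C \<omega> = C 1 * \<omega> + 2 * (\<Sum>k. sin (\<omega> * real (k + 1)) / real (k + 1) * C ((k + 1) + 1))"

definition Delta :: "(nat \<Rightarrow> real) \<Rightarrow> nat \<Rightarrow> real" where
  "Delta C n = 2 / real n * (\<Sum>k\<in>{1..<n}. \<bar>C (k + 1)\<bar>)
     + 2 * (\<Sum>k. \<bar>C ((k + n) + 1)\<bar> / real (k + n))"

end

theory Submission
  imports Defs
begin

text \<open>With the true mean in place of the empirical one, the spectral integral is a quadratic form in the
  observations whose kernel has row sums \<open>O(1 + log n)\<close>. Changing one observation therefore moves it by
  \<open>O((1 + log n) / n)\<close>, and the Devroye inequality bounds its variance at each frequency; its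
  expectation is a Cesaro mean of the series defining \<open>J\<close>, hence within \<open>\<Delta>\<^sub>n\<close> of \<open>J\<close>. Replacing the true
  mean by the empirical one costs \<open>O(1 + log n)\<close> times the error of the empirical mean, which the Devroye
  inequality controls too. Since the empirical distribution function is nondecreasing, its supremum distance
  from \<open>J\<close> is at most the largest distance on the grid \<open>2 \<pi> p / N\<close> plus the oscillation of \<open>J\<close> over one
  mesh, which is \<open>O(C(1) / N + \<Delta>\<^sub>N)\<close>.\<close>

section \<open>The spectral integral as a quadratic form\<close>

text \<open>This is the integral of \<open>cos ((j - l) * s)\<close> over
  \<open>[0, \<omega>]\<close>. The diagonal has its own clause because the quotient would divide by
  zero there.\<close>

definition dkernel :: "real \<Rightarrow> nat \<Rightarrow> nat \<Rightarrow> real" where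
  "dkernel \<omega> j l = (if j = l then \<omega> else sin ((real j - real l) * \<omega>) / (real j - real l))"

text \<open>For \<open>\<omega> \<ge> 0\<close> this is the integrated periodogram of
  \<open>a\<close>. As a finite sum it shows measurability, expectation and the dependence on single
  entries directly.\<close>

definition sform :: "nat \<Rightarrow> (nat \<Rightarrow> real) \<Rightarrow> real \<Rightarrow> real" where
  "sform n a \<omega> = 1 / real n * (\<Sum>j=1..n. \<Sum>l=1..n. a j * a l * dkernel \<omega> j l)"

lemma dkernel_commute: "dkernel \<omega> j l = dkernel \<omega> l j"
proof -
  have "sin ((real l - real j) * \<omega>) = - sin ((real j - real l) * \<omega>)"
    by (metis minus_diff_eq mult_minus_left sin_minus)
  thus ?thesis
    by (auto simp: dkernel_def field_simps)
qed

lemma cmod_trig_sum_squared: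
  fixes a :: "nat \<Rightarrow> real"
  shows "(cmod (\<Sum>j\<in>S. exp (- (\<i> * of_nat j * of_real s)) * of_real (a j)))\<^sup>2
    = (\<Sum>j\<in>S. \<Sum>l\<in>S. a j * a l * cos ((real j - real l) * s))"
proof -
  have e: "exp (- (\<i> * of_nat j * of_real s)) = cis (- (real j * s))" for j
    by (simp add: cis_conv_exp algebra_simps)
  have "(cmod (\<Sum>j\<in>S. exp (- (\<i> * of_nat j * of_real s)) * of_real (a j)))\<^sup>2
     = (\<Sum>j\<in>S. a j * cos (real j * s))\<^sup>2 + (\<Sum>j\<in>S. a j * sin (real j * s))\<^sup>2"
    unfolding e cmod_power2 by (simp add: sum_negf mult.commute)
  also have "\<dots> = (\<Sum>j\<in>S. \<Sum>l\<in>S. a j * a l * cos ((real j - real l) * s))"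
    unfolding power2_eq_square sum_product sum.distrib[symmetric]
    by (intro sum.cong refl) (simp add: left_diff_distrib cos_diff algebra_simps)
  finally show ?thesis .
qed

lemma has_integral_dkernel:
  assumes "0 \<le> \<omega>"
  shows "((\<lambda>s. cos ((real j - real l) * s)) has_integral dkernel \<omega> j l) {0..\<omega>}"
proof (cases "j = l")
  case True
  thus ?thesis using has_integral_const_real[of "1::real" 0 \<omega>] assms by (simp add: dkernel_def)
next
  case False
  define c where "c = real j - real l"
  have c: "c \<noteq> 0" using False by (simp add: c_def)
  have "((\<lambda>s. cos (c * s)) has_integral (sin (c * \<omega>) / c - sin (c * 0) / c)) {0..\<omega>}"
    by (rule fundamental_theorem_of_calculus[OF assms])
       (auto intro!: derivative_eq_intros
          simp: has_real_derivative_iff_has_vector_derivative[symmetric] c)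
  thus ?thesis using False by (simp add: dkernel_def c_def)
qed

lemma integral_periodogram:
  assumes "0 \<le> \<omega>"
  shows "integral {0..\<omega>} (\<lambda>s. 1 / real n *
       (cmod (\<Sum>j=1..n. exp (- (\<i> * of_nat j * of_real s)) * of_real (a j)))\<^sup>2) = sform n a \<omega>"
  unfolding cmod_trig_sum_squared sform_def
  by (intro integral_unique has_integral_mult_right has_integral_sum has_integral_dkernel assms) auto

text \<open>The kernel entries change sign, so monotonicity is read off the integral form, whose
  integrand is a nonnegative multiple of a square.\<close>

lemma sform_mono:
  assumes "0 \<le> \<omega>" "\<omega> \<le> \<omega>'"
  shows "sform n a \<omega> \<le> sform n a \<omega>'"
proof -
  let ?f = "\<lambda>s. 1 / real n *
    (cmod (\<Sum>j=1..n. exp (- (\<i> * of_nat j * of_real s)) * of_real (a j)))\<^sup>2"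
  have "?f integrable_on {0..t}" for t
    by (intro integrable_continuous_real continuous_intros)
  hence "integral {0..\<omega>} ?f \<le> integral {0..\<omega>'} ?f"
    using assms by (intro integral_subset_le) auto
  thus ?thesis using assms by (simp only: integral_periodogram order_trans[OF assms])
qed

section \<open>Logarithmic row sums and stability of the form\<close>

lemma sum_inverse_le_ln:
  assumes "n \<ge> 1"
  shows "(\<Sum>k=1..n. 1 / real k) \<le> 1 + ln (real n)"
  using assms
proof (induction n rule: nat_induct_at_least)
  case (Suc n)
  \<comment> \<open>The inequality \<open>ln x \<le> x - 1\<close> at \<open>x = n / (n + 1)\<close>
    bounds the new harmonic term by the increment of the logarithm.\<close>
  have "ln (real n / real (Suc n)) \<le> real n / real (Suc n) - 1"
    using Suc.hyps by (intro ln_le_minus_one) simp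
  hence "1 / real (Suc n) \<le> ln (real (Suc n)) - ln (real n)"
    using Suc.hyps by (simp add: ln_div field_simps)
  thus ?case using Suc.IH by simp
qed simp

text \<open>The diagonal entry contributes at most \<open>2 * pi\<close>, and the entries on either
  side of it at most one harmonic sum each, hence the factor \<open>2 * pi + 2\<close>.\<close>

definition row_bound :: "nat \<Rightarrow> real" where
  "row_bound n = (2 * pi + 2) * (1 + ln (real n))"

lemma dkernel_row_sum_le:
  assumes "0 \<le> \<omega>" "\<omega> \<le> 2 * pi" "j \<in> {1..n}"
  shows "(\<Sum>l=1..n. \<bar>dkernel \<omega> j l\<bar>) \<le> row_bound n"
proof -
  have n: "n \<ge> 1" using assms(3) by auto
  have le: "\<bar>dkernel \<omega> j l\<bar> \<le> 1 / \<bar>real j - real l\<bar>" if "j \<noteq> l" for l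
    using that by (simp add: dkernel_def divide_right_mono)
  have "{1..n} = insert j ({1..<j} \<union> {j<..n})" using assms(3) by auto
  hence "(\<Sum>l=1..n. \<bar>dkernel \<omega> j l\<bar>) =
      \<omega> + ((\<Sum>l\<in>{1..<j}. \<bar>dkernel \<omega> j l\<bar>) + (\<Sum>l\<in>{j<..n}. \<bar>dkernel \<omega> j l\<bar>))"
    using assms(1) by (simp only:) (subst sum.insert; (subst sum.union_disjoint)?; auto simp: dkernel_def)
  moreover have "(\<Sum>l\<in>{1..<j}. \<bar>dkernel \<omega> j l\<bar>) \<le> (\<Sum>k=1..n. 1 / real k)"
  proof -
    have "(\<Sum>l\<in>{1..<j}. \<bar>dkernel \<omega> j l\<bar>) \<le> (\<Sum>l\<in>{1..<j}. 1 / real (j - l))"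
      by (rule sum_mono, rule order_trans[OF le]) (auto simp: of_nat_diff)
    also have "\<dots> = (\<Sum>k\<in>(\<lambda>l. j - l) ` {1..<j}. 1 / real k)"
      by (subst sum.reindex) (auto intro!: inj_onI)
    also have "\<dots> \<le> (\<Sum>k=1..n. 1 / real k)"
      using assms(3) by (intro sum_mono2) auto
    finally show ?thesis .
  qed
  moreover have "(\<Sum>l\<in>{j<..n}. \<bar>dkernel \<omega> j l\<bar>) \<le> (\<Sum>k=1..n. 1 / real k)"
  proof -
    have "(\<Sum>l\<in>{j<..n}. \<bar>dkernel \<omega> j l\<bar>) \<le> (\<Sum>l\<in>{j<..n}. 1 / real (l - j))"
      by (rule sum_mono, rule order_trans[OF le]) (auto simp: of_nat_diff)
    also have "\<dots> = (\<Sum>k\<in>(\<lambda>l. l - j) ` {j<..n}. 1 / real k)"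
      by (subst sum.reindex) (auto intro!: inj_onI)
    also have "\<dots> \<le> (\<Sum>k=1..n. 1 / real k)"
      by (intro sum_mono2) auto
    finally show ?thesis .
  qed
  moreover have "2 * pi * 1 \<le> 2 * pi * (1 + ln (real n))"
    using n by (intro mult_left_mono) auto
  ultimately show ?thesis
    using sum_inverse_le_ln[OF n] assms(2) unfolding row_bound_def by (simp add: algebra_simps)
qed

text \<open>The analogue of \<open>a^2 - b^2 = (a - b) (a + b)\<close>: the cross terms cancel
  because the kernel is symmetric.\<close>

lemma sform_diff:
  "sform n a \<omega> - sform n b \<omega>
     = 1 / real n * (\<Sum>j=1..n. (a j - b j) * (\<Sum>l=1..n. (a l + b l) * dkernel \<omega> j l))"
proof -
  let ?k = "dkernel \<omega>" and ?S = "{1..n}"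
  have "(\<Sum>j\<in>?S. \<Sum>l\<in>?S. a j * b l * ?k j l) = (\<Sum>l\<in>?S. \<Sum>j\<in>?S. a j * b l * ?k j l)"
    by (rule sum.swap)
  also have "\<dots> = (\<Sum>j\<in>?S. \<Sum>l\<in>?S. b j * a l * ?k j l)"
    by (intro sum.cong refl) (simp add: dkernel_commute mult.commute)
  finally have s: "(\<Sum>j\<in>?S. \<Sum>l\<in>?S. a j * b l * ?k j l) = (\<Sum>j\<in>?S. \<Sum>l\<in>?S. b j * a l * ?k j l)" .
  have "(\<Sum>j\<in>?S. (a j - b j) * (\<Sum>l\<in>?S. (a l + b l) * ?k j l))
     = (\<Sum>j\<in>?S. \<Sum>l\<in>?S. a j * a l * ?k j l + a j * b l * ?k j l - b j * a l * ?k j l - b j * b l * ?k j l)"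
    unfolding sum_distrib_left by (intro sum.cong refl) (simp add: algebra_simps)
  also have "\<dots> = (\<Sum>j\<in>?S. \<Sum>l\<in>?S. a j * a l * ?k j l) - (\<Sum>j\<in>?S. \<Sum>l\<in>?S. b j * b l * ?k j l)"
    using s by (simp add: sum.distrib sum_subtractf)
  finally show ?thesis by (simp add: sform_def right_diff_distrib)
qed

text \<open>The factor \<open>a + b\<close> is absorbed by a row sum of the kernel, so only one sum
  of differences remains. This one estimate serves for changing a single observation, for replacing
  the mean, and, with \<open>b = 0\<close>, for bounding the form itself.\<close>

lemma sform_diff_le:
  assumes "0 \<le> \<omega>" "\<omega> \<le> 2 * pi" and c: "\<And>l. l \<in> {1..n} \<Longrightarrow> \<bar>a l + b l\<bar> \<le> c"
  shows "\<bar>sform n a \<omega> - sform n b \<omega>\<bar> \<le> c * row_bound n / real n * (\<Sum>j=1..n. \<bar>a j - b j\<bar>)"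
proof (cases "n = 0")
  case False
  have c0: "0 \<le> c" using c[of 1] False by (auto intro: order_trans[OF abs_ge_zero])
  have row: "\<bar>\<Sum>l=1..n. (a l + b l) * dkernel \<omega> j l\<bar> \<le> c * row_bound n" if j: "j \<in> {1..n}" for j
  proof -
    have "\<bar>\<Sum>l=1..n. (a l + b l) * dkernel \<omega> j l\<bar> \<le> (\<Sum>l=1..n. c * \<bar>dkernel \<omega> j l\<bar>)"
      by (rule order_trans[OF sum_abs], rule sum_mono) (auto simp: abs_mult intro!: mult_right_mono c)
    also have "\<dots> \<le> c * row_bound n"
      unfolding sum_distrib_left[symmetric]
      by (intro mult_left_mono dkernel_row_sum_le[OF assms(1,2) j] c0)
    finally show ?thesis .
  qed
  have "\<bar>\<Sum>j=1..n. (a j - b j) * (\<Sum>l=1..n. (a l + b l) * dkernel \<omega> j l)\<bar>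
      \<le> (\<Sum>j=1..n. \<bar>a j - b j\<bar> * (c * row_bound n))"
    by (rule order_trans[OF sum_abs], rule sum_mono, unfold abs_mult) (intro mult_left_mono row abs_ge_zero)
  also have "\<dots> = c * row_bound n * (\<Sum>j=1..n. \<bar>a j - b j\<bar>)"
    unfolding sum_distrib_left by (intro sum.cong refl) (simp add: ac_simps)
  finally show ?thesis
    unfolding sform_diff by (simp add: abs_mult divide_right_mono)
qed (simp add: sform_def)

section \<open>Cesaro means of the limit series\<close>

text \<open>A lag \<open>k > 0\<close> occurs \<open>n - k\<close> times on each side of the
  diagonal. Truncated subtraction forces \<open>max - min\<close> as the way to write the lag; the
  induction adds the last row and column.\<close>

lemma toeplitz_sum:
  fixes f :: "nat \<Rightarrow> real"
  shows "(\<Sum>j=1..n. \<Sum>l=1..n. f (max j l - min j l))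
      = real n * f 0 + 2 * (\<Sum>k\<in>{1..<n}. real (n - k) * f k)"
proof (induction n)
  case (Suc n)
  have a: "(\<Sum>j=1..n. f (max j (Suc n) - min j (Suc n))) = (\<Sum>k=1..n. f k)"
    by (rule sum.reindex_bij_witness[of _ "\<lambda>k. Suc n - k" "\<lambda>j. Suc n - j"]) auto
  have b: "(\<Sum>l=1..n. f (max (Suc n) l - min (Suc n) l)) = (\<Sum>k=1..n. f k)"
    using a by (simp add: max.commute min.commute)
  have "(\<Sum>k\<in>{1..<Suc n}. real (Suc n - k) * f k) = (\<Sum>k\<in>{1..<Suc n}. real (n - k) * f k + f k)"
    by (intro sum.cong refl) (auto simp: Suc_diff_le algebra_simps)
  \<comment> \<open>The lag \<open>k = n\<close> has weight \<open>real (n - n) = 0\<close>, so it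
    drops out of the first sum.\<close>
  also have "\<dots> = (\<Sum>k\<in>{1..<n}. real (n - k) * f k) + (\<Sum>k=1..n. f k)"
    by (cases n) (auto simp: sum.distrib atLeastLessThanSuc_atLeastAtMost atLeastAtMostSuc_conv)
  finally show ?case using Suc.IH a b
    by (simp add: sum.distrib algebra_simps)
qed simp

text \<open>This is the expectation of the spectral integral when the true mean is subtracted.\<close>

definition cesaro_spectral :: "(nat \<Rightarrow> real) \<Rightarrow> nat \<Rightarrow> real \<Rightarrow> real" where
  "cesaro_spectral C n \<omega> = C 1 * \<omega> +
     2 * (\<Sum>k\<in>{1..<n}. (1 - real k / real n) * (sin (real k * \<omega>) / real k) * C (k + 1))"

lemma dkernel_mean_eq_cesaro:
  assumes "n \<ge> 1"
  shows "1 / real n * (\<Sum>j=1..n. \<Sum>l=1..n. C (max j l - min j l + 1) * dkernel \<omega> j l)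
     = cesaro_spectral C n \<omega>"
proof -
  \<comment> \<open>Both factors depend on the lag alone. The argument \<open>k + 1\<close> reflects
    the convention that \<open>C 1\<close> is the variance, that is, lag zero.\<close>
  define f where "f k = C (k + 1) * (if k = 0 then \<omega> else sin (real k * \<omega>) / real k)" for k
  have "C (max j l - min j l + 1) * dkernel \<omega> j l = f (max j l - min j l)" for j l
  proof (cases j l rule: linorder_cases)
    case less
    hence "dkernel \<omega> j l = sin (real (l - j) * \<omega>) / real (l - j)"
      by (subst dkernel_commute) (simp add: dkernel_def of_nat_diff)
    thus ?thesis using less by (simp add: f_def max_def min_def)
  next
    case greater
    hence "dkernel \<omega> j l = sin (real (j - l) * \<omega>) / real (j - l)"
      by (simp add: dkernel_def of_nat_diff)
    thus ?thesis using greater by (simp add: f_def max_def min_def)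
  qed (simp add: f_def dkernel_def)
  hence "1 / real n * (\<Sum>j=1..n. \<Sum>l=1..n. C (max j l - min j l + 1) * dkernel \<omega> j l)
     = 1 / real n * (real n * f 0 + 2 * (\<Sum>k\<in>{1..<n}. real (n - k) * f k))"
    by (simp only: toeplitz_sum)
  also have "\<dots> = f 0 + 2 * (\<Sum>k\<in>{1..<n}. real (n - k) / real n * f k)"
    using assms by (simp add: add_divide_distrib sum_divide_distrib sum_distrib_left)
  also have "(\<Sum>k\<in>{1..<n}. real (n - k) / real n * f k)
     = (\<Sum>k\<in>{1..<n}. (1 - real k / real n) * (sin (real k * \<omega>) / real k) * C (k + 1))"
    by (intro sum.cong refl) (auto simp: f_def of_nat_diff diff_divide_distrib)
  finally show ?thesis by (simp add: cesaro_spectral_def f_def)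
qed

text \<open>The hypothesis weights \<open>C (k + 1)\<close> by \<open>1 / (k + 1)\<close>, the tail
  in \<open>Delta\<close> by \<open>1 / k\<close>; the two weights differ by a factor of at most 2
  when \<open>k \<ge> 1\<close>.\<close>

lemma summable_tail_autocov:
  fixes C :: "nat \<Rightarrow> real"
  assumes "summable (\<lambda>l. \<bar>C (l + 1)\<bar> / real (l + 1))" "n \<ge> 1"
  shows "summable (\<lambda>k. \<bar>C ((k + n) + 1)\<bar> / real (k + n))"
proof (rule summable_comparison_test')
  show "summable (\<lambda>k. 2 * (\<bar>C ((k + n) + 1)\<bar> / real ((k + n) + 1)))"
    using summable_mult[OF summable_ignore_initial_segment[OF assms(1), of n]] .
  show "norm (\<bar>C ((k + n) + 1)\<bar> / real (k + n)) \<le> 2 * (\<bar>C ((k + n) + 1)\<bar> / real ((k + n) + 1))" for k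
  proof -
    have "1 / real (k + n) \<le> 2 / real ((k + n) + 1)"
      using assms(2) by (simp add: field_simps)
    from mult_left_mono[OF this, of "\<bar>C ((k + n) + 1)\<bar>"] show ?thesis by (simp add: ac_simps)
  qed
qed

text \<open>Each series term is at most \<open>\<bar>C (k + 1)\<bar> / k\<close>. For
  \<open>k < n\<close> the Cesaro weight loses the fraction \<open>k / n\<close> of it, which gives
  the first sum in \<open>Delta\<close>; the terms with \<open>k \<ge> n\<close> are lost entirely
  and give the second.\<close>

lemma cesaro_spectral_approx:
  fixes C :: "nat \<Rightarrow> real"
  assumes sm: "summable (\<lambda>l. \<bar>C (l + 1)\<bar> / real (l + 1))" and n: "n \<ge> 1"
  shows "\<bar>cesaro_spectral C n \<omega> - spectral C \<omega>\<bar> \<le> Delta C n"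
proof -
  define g where "g k = sin (\<omega> * real k) / real k * C (k + 1)" for k
  have g_le: "\<bar>g k\<bar> \<le> \<bar>C (k + 1)\<bar> / real k" for k
    using mult_right_mono[OF abs_sin_le_one[of "\<omega> * real k"], of "\<bar>C (k + 1)\<bar> / real k"]
    by (simp add: g_def abs_mult)
  have tail: "summable (\<lambda>k. \<bar>g (k + n)\<bar>)"
  proof (rule summable_comparison_test'[OF summable_tail_autocov[OF sm n], of 0])
    show "norm \<bar>g (k + n)\<bar> \<le> \<bar>C ((k + n) + 1)\<bar> / real (k + n)" for k
      using g_le[of "k + n"] by simp
  qed
  have "summable (\<lambda>k. g (k + n))"
    using tail by (rule summable_rabs_cancel)
  hence sg: "summable (\<lambda>k. g (k + 1))"
    by (metis summable_iff_shift)
  \<comment> \<open>The split is at \<open>n - 1\<close> because the series is indexed from 0 while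
    its terms start at \<open>g 1\<close>.\<close>
  have "(\<Sum>k. g (k + 1)) = (\<Sum>k. g (k + (n - 1) + 1)) + (\<Sum>k<n - 1. g (k + 1))"
    by (rule suminf_split_initial_segment[OF sg])
  also have "(\<Sum>k<n - 1. g (k + 1)) = (\<Sum>k\<in>{1..<n}. g k)"
    by (rule sum.reindex_bij_witness[of _ "\<lambda>k. k - 1" "\<lambda>k. k + 1"]) auto
  also have "(\<lambda>k. g (k + (n - 1) + 1)) = (\<lambda>k. g (k + n))"
    using n by (intro ext arg_cong[of _ _ g]) simp
  finally have J: "spectral C \<omega> = C 1 * \<omega> + 2 * ((\<Sum>k. g (k + n)) + (\<Sum>k\<in>{1..<n}. g k))"
    by (simp add: spectral_def g_def)
  have "(1 - real k / real n) * (sin (real k * \<omega>) / real k) * C (k + 1) = g k - real k / real n * g k" for k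
    by (simp only: g_def left_diff_distrib mult_1_left mult.commute[of \<omega>] mult.assoc)
  hence "cesaro_spectral C n \<omega> = C 1 * \<omega> + 2 * (\<Sum>k\<in>{1..<n}. g k - real k / real n * g k)"
    by (simp only: cesaro_spectral_def)
  hence "cesaro_spectral C n \<omega> - spectral C \<omega>
     = - 2 * (\<Sum>k\<in>{1..<n}. real k / real n * g k) - 2 * (\<Sum>k. g (k + n))"
    by (simp add: J sum_subtractf)
  also have "\<bar>\<dots>\<bar> \<le> 2 * \<bar>\<Sum>k\<in>{1..<n}. real k / real n * g k\<bar> + 2 * \<bar>\<Sum>k. g (k + n)\<bar>"
    by (simp only: abs_le_iff) linarith
  also have "\<bar>\<Sum>k\<in>{1..<n}. real k / real n * g k\<bar> \<le> (\<Sum>k\<in>{1..<n}. \<bar>C (k + 1)\<bar> / real n)"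
  proof (rule order_trans[OF sum_abs], rule sum_mono)
    fix k assume "k \<in> {1..<n}"
    thus "\<bar>real k / real n * g k\<bar> \<le> \<bar>C (k + 1)\<bar> / real n"
      using mult_left_mono[OF g_le[of k], of "real k / real n"] by (simp add: abs_mult)
  qed
  also have "\<bar>\<Sum>k. g (k + n)\<bar> \<le> (\<Sum>k. \<bar>g (k + n)\<bar>)"
    by (rule summable_rabs[OF tail])
  also have "\<dots> \<le> (\<Sum>k. \<bar>C ((k + n) + 1)\<bar> / real (k + n))"
    by (intro suminf_le tail summable_tail_autocov sm n g_le)
  finally show ?thesis
    by (simp add: Delta_def sum_divide_distrib[symmetric])
qed

lemma Delta_ge:
  assumes sm: "summable (\<lambda>l. \<bar>C (l + 1)\<bar> / real (l + 1))" and n: "n \<ge> 1"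
  shows "2 / real n * (\<Sum>k\<in>{1..<n}. \<bar>C (k + 1)\<bar>) \<le> Delta C n"
  unfolding Delta_def using suminf_nonneg[OF summable_tail_autocov[OF assms]] by simp

section \<open>Oscillation of the limit and reduction to a grid\<close>

lemma abs_sin_diff_le: "\<bar>sin x - sin y\<bar> \<le> \<bar>x - y\<bar>" for x y :: real
proof -
  have "\<bar>sin x - sin y\<bar> = 2 * \<bar>sin ((x - y) / 2)\<bar> * \<bar>cos ((x + y) / 2)\<bar>"
    by (simp add: sin_diff_sin abs_mult)
  also have "\<dots> \<le> 2 * \<bar>(x - y) / 2\<bar> * 1"
    by (intro mult_mono mult_left_mono abs_sin_x_le_abs_x abs_cos_le_one) auto
  finally show ?thesis by simp
qed

text \<open>Termwise differentiation of the limit series may diverge, so it is replaced at both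
  points by its Cesaro mean of order \<open>N\<close>, at cost \<open>Delta C N\<close> each. That
  mean has Lipschitz constant at most \<open>C 1 + 2 * ?S\<close>, and on a mesh of
  \<open>2 * pi / N\<close> the second part is again controlled by \<open>Delta C N\<close>.\<close>

lemma spectral_oscillation:
  fixes C :: "nat \<Rightarrow> real"
  assumes sm: "summable (\<lambda>l. \<bar>C (l + 1)\<bar> / real (l + 1))" and N: "N \<ge> 1" and C1: "0 \<le> C 1"
    and d: "\<bar>x - y\<bar> \<le> 2 * pi / real N"
  shows "\<bar>spectral C x - spectral C y\<bar> \<le> (2 * pi + 2) * (C 1 / real N + Delta C N)"
proof -
  let ?S = "\<Sum>k\<in>{1..<N}. \<bar>C (k + 1)\<bar>"
  define T where "T = (\<Sum>k\<in>{1..<N}. (1 - real k / real N) *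
    ((sin (real k * x) - sin (real k * y)) / real k) * C (k + 1))"
  have diff: "cesaro_spectral C N x - cesaro_spectral C N y = C 1 * (x - y) + 2 * T"
    by (simp add: T_def cesaro_spectral_def sum_subtractf sum.distrib diff_divide_distrib algebra_simps)
  have "\<bar>T\<bar> \<le> (\<Sum>k\<in>{1..<N}. \<bar>x - y\<bar> * \<bar>C (k + 1)\<bar>)"
    unfolding T_def
  proof (rule order_trans[OF sum_abs], rule sum_mono)
    fix k assume k: "k \<in> {1..<N}"
    have "\<bar>sin (real k * x) - sin (real k * y)\<bar> \<le> real k * \<bar>x - y\<bar>"
      using abs_sin_diff_le[of "real k * x" "real k * y"] by (simp add: right_diff_distrib[symmetric] abs_mult)
    hence "\<bar>(sin (real k * x) - sin (real k * y)) / real k\<bar> \<le> \<bar>x - y\<bar>"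
      using k by (simp add: field_simps)
    moreover have "\<bar>1 - real k / real N\<bar> \<le> 1"
      using k by (simp add: field_simps)
    ultimately have "\<bar>1 - real k / real N\<bar> * \<bar>(sin (real k * x) - sin (real k * y)) / real k\<bar> \<le> 1 * \<bar>x - y\<bar>"
      by (intro mult_mono) auto
    thus "\<bar>(1 - real k / real N) * ((sin (real k * x) - sin (real k * y)) / real k) * C (k + 1)\<bar>
       \<le> \<bar>x - y\<bar> * \<bar>C (k + 1)\<bar>"
      unfolding abs_mult[of _ "C (k + 1)"] abs_mult[of "1 - real k / real N"] mult_1_left
      by (rule mult_right_mono) (rule abs_ge_zero)
  qed
  hence T: "\<bar>T\<bar> \<le> \<bar>x - y\<bar> * ?S"
    by (simp only: sum_distrib_left)
  have C1_abs: "\<bar>C 1 * (x - y)\<bar> = \<bar>x - y\<bar> * C 1"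
    using C1 by (simp add: abs_mult mult.commute)
  have "\<bar>cesaro_spectral C N x - cesaro_spectral C N y\<bar> \<le> \<bar>x - y\<bar> * C 1 + 2 * (\<bar>x - y\<bar> * ?S)"
    using T unfolding diff C1_abs[symmetric] by linarith
  also have "\<dots> = \<bar>x - y\<bar> * (C 1 + 2 * ?S)"
    by (simp add: distrib_left)
  also have "\<dots> \<le> 2 * pi / real N * (C 1 + 2 * ?S)"
    using C1 by (intro mult_right_mono d) (auto intro!: add_nonneg_nonneg sum_nonneg)
  also have "\<dots> = 2 * pi * (C 1 / real N + 2 / real N * ?S)"
    by (simp add: add_divide_distrib distrib_left)
  also have "\<dots> \<le> 2 * pi * (C 1 / real N + Delta C N)"
    using Delta_ge[OF sm N] by (intro mult_left_mono add_left_mono) auto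
  finally have cesaro: "\<bar>cesaro_spectral C N x - cesaro_spectral C N y\<bar>
      \<le> 2 * pi * (C 1 / real N + Delta C N)" .
  \<comment> \<open>Adding the nonnegative \<open>c = C 1 / real N\<close> to each approximation
    error lets both summands share the factor \<open>2 * pi + 2\<close>.\<close>
  have triangle: "\<bar>a - b\<bar> \<le> r \<Longrightarrow> \<bar>a - a'\<bar> \<le> e \<Longrightarrow> \<bar>b - b'\<bar> \<le> e \<Longrightarrow> 0 \<le> c \<Longrightarrow> \<bar>a' - b'\<bar> \<le> r + 2 * (c + e)"
    for a b a' b' c e r :: real
    unfolding abs_le_iff by simp
  have "0 \<le> C 1 / real N" using C1 by simp
  from triangle[OF cesaro cesaro_spectral_approx[OF sm N] cesaro_spectral_approx[OF sm N] this]
  show ?thesis by (simp only: distrib_right)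
qed

text \<open>The maximum over the grid is replaced by a sum of squares so that expectations can be
  taken term by term. The node 0 is absent from the sum because \<open>F\<close> and
  \<open>G\<close> agree there.\<close>

lemma grid_deviation_le:
  fixes F G :: "real \<Rightarrow> real"
  assumes mono: "\<And>x y. 0 \<le> x \<Longrightarrow> x \<le> y \<Longrightarrow> F x \<le> F y"
    and zero: "F 0 = G 0" and N: "N \<ge> 1" and T: "0 < T"
    and osc: "\<And>x y. \<bar>x - y\<bar> \<le> T / real N \<Longrightarrow> \<bar>G x - G y\<bar> \<le> \<delta>"
    and w: "0 \<le> \<omega>" "\<omega> \<le> T"
  shows "(F \<omega> - G \<omega>)\<^sup>2
    \<le> 2 * (\<Sum>p=1..N. (F (T * real p / real N) - G (T * real p / real N))\<^sup>2) + 2 * \<delta>\<^sup>2"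
proof -
  define t where "t p = T * real p / real N" for p
  let ?S = "\<Sum>p=1..N. (F (t p) - G (t p))\<^sup>2"
  have d0: "0 \<le> \<delta>" using osc[of 0 0] T by simp
  have t_nonneg: "0 \<le> t p" for p using T by (simp add: t_def)
  have "\<exists>q\<in>{0..N}. \<bar>F \<omega> - G \<omega>\<bar> \<le> \<bar>F (t q) - G (t q)\<bar> + \<delta>"
  \<comment> \<open>The right endpoint is separate: rounding down would give \<open>p = N\<close>,
    whose successor lies outside the grid.\<close>
  proof (cases "\<omega> = T")
    case True
    hence "t N = \<omega>" using N by (simp add: t_def)
    thus ?thesis using d0 by (intro bexI[of _ N]) auto
  next
    case False
    define p where "p = nat \<lfloor>\<omega> * real N / T\<rfloor>"
    have q0: "0 \<le> \<omega> * real N / T" using w T by simp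
    have "\<omega> * real N / T < real N" using False w T N by (simp add: field_simps)
    moreover have p1: "real p \<le> \<omega> * real N / T" and p2: "\<omega> * real N / T < real p + 1"
      using q0 unfolding p_def by linarith+
    ultimately have pN: "p < N" by linarith
    have tp: "t p \<le> \<omega>" "\<omega> \<le> t (Suc p)" and step: "t (Suc p) - t p = T / real N"
      using p1 p2 T N by (auto simp: t_def field_simps)
    have "F (t p) \<le> F \<omega>" "F \<omega> \<le> F (t (Suc p))"
      using tp w t_nonneg by (auto intro: mono)
    moreover have "\<bar>G \<omega> - G (t p)\<bar> \<le> \<delta>" "\<bar>G \<omega> - G (t (Suc p))\<bar> \<le> \<delta>"
      using tp step by (auto intro!: osc)
    \<comment> \<open>If \<open>F \<omega>\<close> exceeds \<open>G \<omega>\<close>, the right node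
      dominates the deviation; otherwise the left node does.\<close>
    ultimately have "\<bar>F \<omega> - G \<omega>\<bar> \<le> \<bar>F (t p) - G (t p)\<bar> + \<delta>
        \<or> \<bar>F \<omega> - G \<omega>\<bar> \<le> \<bar>F (t (Suc p)) - G (t (Suc p))\<bar> + \<delta>"
      by linarith
    thus ?thesis using pN by (auto intro: bexI[of _ p] bexI[of _ "Suc p"])
  qed
  then obtain q where q: "q \<le> N" "\<bar>F \<omega> - G \<omega>\<bar> \<le> \<bar>F (t q) - G (t q)\<bar> + \<delta>" by auto
  have "(F (t q) - G (t q))\<^sup>2 \<le> ?S"
  proof (cases "q = 0")
    case True
    thus ?thesis using zero by (auto simp: t_def intro!: sum_nonneg)
  next
    case False
    thus ?thesis using q(1) by (intro member_le_sum) auto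
  qed
  moreover have "(F \<omega> - G \<omega>)\<^sup>2 \<le> (\<bar>F (t q) - G (t q)\<bar> + \<delta>)\<^sup>2"
    using q(2) by (metis abs_ge_zero power2_abs power_mono)
  moreover have "\<dots> \<le> 2 * (F (t q) - G (t q))\<^sup>2 + 2 * \<delta>\<^sup>2"
    using sum_squares_bound[of "\<bar>F (t q) - G (t q)\<bar>" \<delta>] by (simp add: power2_sum)
  ultimately show ?thesis by (simp add: t_def)
qed

section \<open>Measurability, stationarity and the Devroye inequality\<close>

lemma borel_measurable_hoelder:
  fixes U :: "'b::{real_normed_vector} \<Rightarrow> real"
  assumes "0 < \<eta>" and h: "\<And>x y. \<bar>U x - U y\<bar> \<le> L * norm (x - y) powr \<eta>"
  shows "U \<in> borel_measurable borel"
proof (rule borel_measurable_continuous_onI, unfold continuous_on_eq_continuous_at[OF open_UNIV] continuous_at, intro ballI)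
  fix x :: 'b
  have "((\<lambda>y. L * norm (y - x) powr \<eta>) \<longlongrightarrow> L * norm (x - x) powr \<eta>) (at x)"
    using assms(1) by (intro tendsto_intros tendsto_powr') (auto intro!: tendsto_intros)
  hence "((\<lambda>y. L * norm (y - x) powr \<eta>) \<longlongrightarrow> 0) (at x)" by simp
  hence "((\<lambda>y. U y - U x) \<longlongrightarrow> 0) (at x)"
    by (rule Lim_null_comparison[rotated]) (simp add: h)
  thus "(U \<longlongrightarrow> U x) (at x)" by (simp add: LIM_zero_iff)
qed

text \<open>Stationarity is stated for the path law; changes of variables along the path map and the
  shift carry it back to expectations over \<open>M\<close>.\<close>

lemma (in prob_space) stationary_expectation_shift:
  fixes X :: "nat \<Rightarrow> 'a \<Rightarrow> real ^ 'd"
  assumes X: "\<And>k. k \<ge> 1 \<Longrightarrow> X k \<in> borel_measurable M" and st: "stationary M X"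
    and f: "f \<in> borel_measurable (seq_space :: (nat \<Rightarrow> real ^ 'd) measure)"
  shows "expectation (\<lambda>x. f (\<lambda>k\<in>{1..}. X k x)) = (expectation (\<lambda>x. f (\<lambda>k\<in>{1..}. X (k + 1) x)) :: real)"
proof -
  let ?path = "\<lambda>x. \<lambda>k\<in>{1..}. X k x"
  have p: "?path \<in> measurable M seq_space"
    unfolding seq_space_def by (rule measurable_restrict) (auto intro: X)
  have s: "shift \<in> measurable seq_space (seq_space :: (nat \<Rightarrow> real ^ 'd) measure)"
    unfolding seq_space_def shift_def
    by (rule measurable_restrict) (rule measurable_component_singleton, simp)
  have "expectation (\<lambda>x. f (?path x)) = integral\<^sup>L (path_law M X) f"
    unfolding path_law_def by (rule integral_distr[symmetric, OF p f])
  also have "\<dots> = integral\<^sup>L (distr (path_law M X) seq_space shift) f"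
    using st by (simp add: stationary_def)
  also have "\<dots> = integral\<^sup>L (path_law M X) (\<lambda>x. f (shift x))"
    using s by (intro integral_distr f) (simp add: path_law_def)
  also have "\<dots> = expectation (\<lambda>x. f (shift (?path x)))"
    unfolding path_law_def by (intro integral_distr p measurable_compose[OF s f])
  also have "(\<lambda>x. f (shift (?path x))) = (\<lambda>x. f (\<lambda>k\<in>{1..}. X (k + 1) x))"
    by (intro ext arg_cong[of _ _ f]) (simp add: shift_def)
  finally show ?thesis .
qed

text \<open>The one-step shift is iterated \<open>i\<close> times. Taking \<open>g\<close>
  constantly 1 gives the corresponding fact for a single time.\<close>

lemma (in prob_space) stationary_expectation_pair:
  fixes X :: "nat \<Rightarrow> 'a \<Rightarrow> real ^ 'd" and f g :: "real ^ 'd \<Rightarrow> real"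
  assumes X: "\<And>k. k \<ge> 1 \<Longrightarrow> X k \<in> borel_measurable M" and st: "stationary M X"
    and [measurable]: "f \<in> borel_measurable borel" "g \<in> borel_measurable borel"
    and "j \<ge> 1" "l \<ge> 1"
  shows "expectation (\<lambda>x. f (X (j + i) x) * g (X (l + i) x)) = expectation (\<lambda>x. f (X j x) * g (X l x))"
proof (induction i)
  case (Suc i)
  have c: "(\<lambda>s :: nat \<Rightarrow> real ^ 'd. h (s k)) \<in> borel_measurable seq_space"
    if "k \<ge> 1" "h \<in> borel_measurable borel" for k and h :: "real ^ 'd \<Rightarrow> real"
    using that unfolding seq_space_def
    by (intro measurable_compose[OF measurable_component_singleton]) auto
  have "(\<lambda>s :: nat \<Rightarrow> real ^ 'd. f (s (j + i)) * g (s (l + i))) \<in> borel_measurable seq_space"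
    using assms by (intro borel_measurable_times c) auto
  from stationary_expectation_shift[OF X st this] show ?case
    using assms Suc.IH by simp
qed simp

text \<open>A common bound \<open>c\<close> for all coordinates replaces the \<open>n\<close>
  suprema, so later estimates never mention \<open>sep_const\<close>.\<close>

lemma (in prob_space) variance_le_devroye:
  fixes X :: "nat \<Rightarrow> 'a \<Rightarrow> real ^ 'd" and K :: "(nat \<Rightarrow> real ^ 'd) \<Rightarrow> real"
  assumes dev: "devroye_const M X \<eta> D" and n: "n \<ge> 1"
    and K: "\<And>x j y. j \<in> {1..n} \<Longrightarrow> \<bar>K x - K (x(j := y))\<bar> \<le> c * norm (x j - y) powr \<eta>"
  shows "variance (\<lambda>x. K (\<lambda>j\<in>{1..n}. X j x)) \<le> D * (real n * c\<^sup>2)"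
proof -
  have le: "q \<le> c" and nonneg: "0 \<le> q" if "q \<in> sep_quotients \<eta> n K j" "j \<in> {1..n}" for q j
    using that K[OF that(2)] by (auto simp: sep_quotients_def divide_le_eq)
  have sep: "sep_hoelder \<eta> n K"
    unfolding sep_hoelder_def by (intro ballI bdd_aboveI[of _ c] le)
  have "(sep_const \<eta> n K j)\<^sup>2 \<le> c\<^sup>2" if j: "j \<in> {1..n}" for j
  proof -
    \<comment> \<open>The supremum is meaningful only for a nonempty set of quotients; moving
      coordinate \<open>j\<close> from the zero vector to the all-ones vector supplies an
      element.\<close>
    define x :: "nat \<Rightarrow> real ^ 'd" where "x = (\<lambda>j\<in>{1..n}. 0)"
    have "(1 :: real ^ 'd) \<noteq> x j" using j by (simp add: x_def vec_eq_iff)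
    moreover have "x \<in> {1..n} \<rightarrow>\<^sub>E UNIV" by (simp add: x_def)
    ultimately obtain q where q: "q \<in> sep_quotients \<eta> n K j"
      unfolding sep_quotients_def by blast
    have "sep_const \<eta> n K j \<le> c"
      unfolding sep_const_def using q le[OF _ j] by (intro cSup_least) auto
    moreover have "0 \<le> sep_const \<eta> n K j"
      unfolding sep_const_def by (intro cSup_upper2[OF q nonneg[OF q j]] bdd_aboveI[of _ c] le[OF _ j])
    ultimately show ?thesis by (intro power_mono)
  qed
  hence "(\<Sum>j=1..n. (sep_const \<eta> n K j)\<^sup>2) \<le> real n * c\<^sup>2"
    using sum_bounded_above[of "{1..n}" "\<lambda>j. (sep_const \<eta> n K j)\<^sup>2" "c\<^sup>2"] by simp
  moreover have "variance (\<lambda>x. K (\<lambda>j\<in>{1..n}. X j x)) \<le> D * (\<Sum>j=1..n. (sep_const \<eta> n K j)\<^sup>2)"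
    using dev n sep unfolding devroye_const_def by blast
  ultimately show ?thesis
    using dev unfolding devroye_const_def by (meson less_imp_le mult_left_mono order_trans)
qed

section \<open>Deviation estimates for a centered bounded observable\<close>

text \<open>The bounds on \<open>U\<close> hold everywhere, not just almost surely, because the
  separate Hoelder constants are suprema over all points.\<close>

locale centered_observable = prob_space M for M :: "'a measure" +
  fixes X :: "nat \<Rightarrow> 'a \<Rightarrow> real ^ 'd" and U :: "real ^ 'd \<Rightarrow> real" and \<eta> D B L :: real
  assumes X_measurable: "\<And>k. k \<ge> 1 \<Longrightarrow> X k \<in> borel_measurable M"
    and stat: "stationary M X"
    and dev: "devroye_const M X \<eta> D"
    and eta_pos: "0 < \<eta>"
    and hoelder_U: "\<And>x y. \<bar>U x - U y\<bar> \<le> L * norm (x - y) powr \<eta>"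
    and U_le: "\<And>x. \<bar>U x\<bar> \<le> B"
    and mean_U: "expectation (\<lambda>x. U (X 1 x)) = 0"
begin

abbreviation cov :: "nat \<Rightarrow> real" where
  "cov k \<equiv> expectation (\<lambda>x. U (X 1 x) * U (X k x))"

definition smean :: "nat \<Rightarrow> 'a \<Rightarrow> real" where
  "smean n x = 1 / real n * (\<Sum>l=1..n. U (X l x))"

lemma U_measurable [measurable]: "U \<in> borel_measurable borel"
  by (rule borel_measurable_hoelder[OF eta_pos hoelder_U])

lemma UX_measurable: "k \<ge> 1 \<Longrightarrow> (\<lambda>x. U (X k x)) \<in> borel_measurable M"
  using measurable_compose[OF X_measurable U_measurable] .

lemma B_nonneg: "0 \<le> B"
  using U_le[of 0] by simp

lemma D_pos: "0 < D"
  using dev by (simp add: devroye_const_def)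

lemma UX_integrable: "k \<ge> 1 \<Longrightarrow> integrable M (\<lambda>x. U (X k x))"
  using U_le by (intro integrable_const_bound[of _ B] UX_measurable) auto

lemma UX_mult_integrable:
  assumes "j \<ge> 1" "l \<ge> 1"
  shows "integrable M (\<lambda>x. U (X j x) * U (X l x))"
  using U_le B_nonneg assms
  by (intro integrable_const_bound[of _ "B * B"] borel_measurable_times UX_measurable)
     (auto simp: abs_mult intro!: mult_mono)

lemma expectation_UX: "k \<ge> 1 \<Longrightarrow> expectation (\<lambda>x. U (X k x)) = 0"
  using stationary_expectation_pair[OF X_measurable stat U_measurable, of "\<lambda>_. 1" 1 1 "k - 1"] mean_U
  by simp

text \<open>Shifting the earlier of the two times to 1 leaves only the lag, and lag zero is
  \<open>cov 1\<close>.\<close>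

lemma expectation_UX_mult:
  assumes "j \<ge> 1" "l \<ge> 1"
  shows "expectation (\<lambda>x. U (X j x) * U (X l x)) = cov (max j l - min j l + 1)"
proof -
  have *: "expectation (\<lambda>x. U (X a x) * U (X b x)) = cov (b - a + 1)" if "1 \<le> a" "a \<le> b" for a b
    using that stationary_expectation_pair[OF X_measurable stat U_measurable U_measurable, of 1 "b - a + 1" "a - 1"]
    by simp
  show ?thesis
    using *[of j l] *[of l j] assms by (cases "j \<le> l") (auto simp: max_def min_def mult.commute)
qed

lemma smean_le: "n \<ge> 1 \<Longrightarrow> \<bar>smean n x\<bar> \<le> B"
proof -
  assume n: "n \<ge> 1"
  have "\<bar>\<Sum>l=1..n. U (X l x)\<bar> \<le> (\<Sum>l=1..n. B)"
    by (rule order_trans[OF sum_abs], rule sum_mono) (rule U_le)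
  thus ?thesis using n by (simp add: smean_def abs_mult field_simps)
qed

lemma smean_measurable: "smean n \<in> borel_measurable M"
  unfolding smean_def by (intro borel_measurable_times borel_measurable_sum borel_measurable_const UX_measurable) auto

lemma expectation_smean: "expectation (smean n) = 0"
  unfolding smean_def by (simp add: Bochner_Integration.integral_sum UX_integrable expectation_UX)

text \<open>One coordinate moves the empirical mean with constant \<open>L / n\<close>, and the mean
  is centered, so its second moment is a variance.\<close>

lemma expectation_smean_squared:
  assumes n: "n \<ge> 1"
  shows "expectation (\<lambda>x. (smean n x)\<^sup>2) \<le> D * L\<^sup>2 / real n"
proof -
  define K where "K y = 1 / real n * (\<Sum>l=1..n. U (y l))" for y :: "nat \<Rightarrow> real ^ 'd"
  have K: "\<bar>K x - K (x(j := y))\<bar> \<le> L / real n * norm (x j - y) powr \<eta>" if j: "j \<in> {1..n}" for x j y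
  proof -
    have "K x - K (x(j := y)) = 1 / real n * (U (x j) - U y)"
      using j unfolding K_def by (simp add: sum.remove[of _ j] add_divide_distrib diff_divide_distrib)
    thus ?thesis using hoelder_U[of "x j" y] n by (simp add: abs_mult divide_right_mono)
  qed
  have e: "K (\<lambda>j\<in>{1..n}. X j x) = smean n x" for x
    by (simp add: K_def smean_def)
  have "expectation (\<lambda>x. (smean n x)\<^sup>2) \<le> D * (real n * (L / real n)\<^sup>2)"
    using variance_le_devroye[OF dev n K] unfolding e expectation_smean by simp
  thus ?thesis using n by (simp add: power2_eq_square field_simps)
qed

lemma expectation_sform:
  assumes n: "n \<ge> 1"
  shows "expectation (\<lambda>x. sform n (\<lambda>j. U (X j x)) \<omega>) = cesaro_spectral cov n \<omega>"
proof -
  have i: "integrable M (\<lambda>x. U (X j x) * U (X l x) * dkernel \<omega> j l)"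
    if "j \<in> {1..n}" "l \<in> {1..n}" for j l
    using that by (intro integrable_mult_left UX_mult_integrable) auto
  have "expectation (\<lambda>x. sform n (\<lambda>j. U (X j x)) \<omega>)
     = 1 / real n * (\<Sum>j=1..n. expectation (\<lambda>x. \<Sum>l=1..n. U (X j x) * U (X l x) * dkernel \<omega> j l))"
    unfolding sform_def integral_mult_right_zero
    by (intro arg_cong2[of _ _ _ _ "(*)"] refl Bochner_Integration.integral_sum
          Bochner_Integration.integrable_sum i)
  also have "\<dots> = 1 / real n * (\<Sum>j=1..n. \<Sum>l=1..n. expectation (\<lambda>x. U (X j x) * U (X l x) * dkernel \<omega> j l))"
    by (intro arg_cong2[of _ _ _ _ "(*)"] sum.cong refl Bochner_Integration.integral_sum i)
  also have "\<dots> = 1 / real n * (\<Sum>j=1..n. \<Sum>l=1..n. cov (max j l - min j l + 1) * dkernel \<omega> j l)"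
    by (intro arg_cong2[of _ _ _ _ "(*)"] sum.cong refl, subst integral_mult_left_zero,
        subst expectation_UX_mult) auto
  also have "\<dots> = cesaro_spectral cov n \<omega>"
    by (rule dkernel_mean_eq_cesaro[OF n])
  finally show ?thesis .
qed

text \<open>When a single coordinate changes, the sum of differences in \<open>sform_diff_le\<close>
  has one nonzero term. The factor 4 is the square of the 2 in
  \<open>\<bar>a + b\<bar> \<le> 2 * B\<close>.\<close>

lemma variance_sform_le:
  assumes n: "n \<ge> 1" and w: "0 \<le> \<omega>" "\<omega> \<le> 2 * pi"
  shows "expectation (\<lambda>x. (sform n (\<lambda>j. U (X j x)) \<omega> - cesaro_spectral cov n \<omega>)\<^sup>2)
     \<le> 4 * (B\<^sup>2 * (row_bound n)\<^sup>2 * (D * L\<^sup>2 / real n))"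
proof -
  define K where "K y = sform n (\<lambda>j. U (y j)) \<omega>" for y :: "nat \<Rightarrow> real ^ 'd"
  let ?c = "2 * B * row_bound n / real n"
  have rb: "0 \<le> row_bound n" using n by (simp add: row_bound_def)
  have K: "\<bar>K x - K (x(j := y))\<bar> \<le> (?c * L) * norm (x j - y) powr \<eta>" if j: "j \<in> {1..n}" for x j y
  proof -
    have "\<bar>K x - K (x(j := y))\<bar> \<le> ?c * (\<Sum>l=1..n. \<bar>U (x l) - U ((x(j := y)) l)\<bar>)"
      unfolding K_def
    proof (rule sform_diff_le[OF w])
      show "\<bar>U (x l) + U ((x(j := y)) l)\<bar> \<le> 2 * B" for l
        using U_le[of "x l"] U_le[of "(x(j := y)) l"] by linarith
    qed
    also have "(\<Sum>l=1..n. \<bar>U (x l) - U ((x(j := y)) l)\<bar>) = \<bar>U (x j) - U y\<bar>"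
      using j by (simp add: sum.remove[of _ j])
    also have "?c * \<bar>U (x j) - U y\<bar> \<le> ?c * (L * norm (x j - y) powr \<eta>)"
      using B_nonneg rb by (intro mult_left_mono hoelder_U) simp
    finally show ?thesis by (simp only: mult.assoc)
  qed
  have e: "K (\<lambda>j\<in>{1..n}. X j x) = sform n (\<lambda>j. U (X j x)) \<omega>" for x
    by (simp add: K_def sform_def)
  have "expectation (\<lambda>x. (sform n (\<lambda>j. U (X j x)) \<omega> - cesaro_spectral cov n \<omega>)\<^sup>2)
     \<le> D * (real n * (?c * L)\<^sup>2)"
    using variance_le_devroye[OF dev n K] unfolding e expectation_sform[OF n] .
  also have "\<dots> = 4 * (B\<^sup>2 * (row_bound n)\<^sup>2 * (D * L\<^sup>2 / real n))"
    using n by (simp add: power2_eq_square field_simps)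
  finally show ?thesis .
qed

text \<open>All \<open>n\<close> differences equal the empirical mean up to sign, so their sum
  cancels the factor \<open>1 / n\<close>; \<open>3 * B\<close> bounds two observations and one
  mean.\<close>

lemma centering_error_le:
  assumes n: "n \<ge> 1" and w: "0 \<le> \<omega>" "\<omega> \<le> 2 * pi"
  shows "\<bar>sform n (\<lambda>j. U (X j x) - smean n x) \<omega> - sform n (\<lambda>j. U (X j x)) \<omega>\<bar>
     \<le> 3 * B * row_bound n * \<bar>smean n x\<bar>"
proof -
  have "\<bar>(U (X l x) - smean n x) + U (X l x)\<bar> \<le> 3 * B" for l
    using U_le[of "X l x"] smean_le[OF n, of x] by linarith
  hence "\<bar>sform n (\<lambda>j. U (X j x) - smean n x) \<omega> - sform n (\<lambda>j. U (X j x)) \<omega>\<bar>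
      \<le> 3 * B * row_bound n / real n * (\<Sum>j=1..n. \<bar>U (X j x) - smean n x - U (X j x)\<bar>)"
    by (intro sform_diff_le[OF w]) auto
  thus ?thesis using n by simp
qed

lemma sform_measurable:
  assumes "\<And>j. j \<ge> 1 \<Longrightarrow> (\<lambda>x. a x j) \<in> borel_measurable M"
  shows "(\<lambda>x. sform n (a x) \<omega>) \<in> borel_measurable M"
  unfolding sform_def using assms
  by (intro borel_measurable_times borel_measurable_sum borel_measurable_const) auto

text \<open>Comparison with the zero form. The bound is crude and serves only for
  integrability.\<close>

lemma sform_abs_le:
  assumes "n \<ge> 1" "0 \<le> \<omega>" "\<omega> \<le> 2 * pi" "\<And>j. \<bar>a j\<bar> \<le> c"
  shows "\<bar>sform n a \<omega>\<bar> \<le> c * row_bound n * c"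
proof -
  have c: "0 \<le> c" using assms(4)[of 0] by linarith
  have rb: "0 \<le> row_bound n" using assms by (simp add: row_bound_def)
  have "\<bar>sform n a \<omega> - sform n (\<lambda>_. 0) \<omega>\<bar> \<le> c * row_bound n / real n * (\<Sum>j=1..n. \<bar>a j - 0\<bar>)"
    using assms by (intro sform_diff_le) auto
  also have "\<dots> \<le> c * row_bound n / real n * (\<Sum>j=1..n. c)"
    using assms c rb by (intro mult_left_mono sum_mono) auto
  finally show ?thesis using assms(1) by (simp add: sform_def)
qed

text \<open>The deviation splits into centering error, fluctuation about the expectation, and bias,
  each squared with a factor 3.\<close>

lemma pointwise_deviation:
  assumes n: "n \<ge> 1" and w: "0 \<le> \<omega>" "\<omega> \<le> 2 * pi"
    and sm: "summable (\<lambda>l. \<bar>cov (l + 1)\<bar> / real (l + 1))"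
  defines "e \<equiv> \<lambda>x. (sform n (\<lambda>j. U (X j x) - smean n x) \<omega> - spectral cov \<omega>)\<^sup>2"
  shows "integrable M e"
    and "expectation e \<le> 39 * (B\<^sup>2 * (row_bound n)\<^sup>2 * (D * L\<^sup>2 / real n)) + 3 * (Delta cov n)\<^sup>2"
proof -
  let ?F = "\<lambda>x. sform n (\<lambda>j. U (X j x) - smean n x) \<omega>"
  let ?G = "\<lambda>x. sform n (\<lambda>j. U (X j x)) \<omega>"
  let ?P = "cesaro_spectral cov n \<omega>" and ?J = "spectral cov \<omega>"
  let ?k = "9 * (B\<^sup>2 * (row_bound n)\<^sup>2)"
  have F: "\<bar>?F x\<bar> \<le> (2 * B) * row_bound n * (2 * B)" for x
  proof (rule sform_abs_le[OF n w])
    show "\<bar>U (X j x) - smean n x\<bar> \<le> 2 * B" for j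
      using U_le[of "X j x"] smean_le[OF n, of x] by linarith
  qed
  have Fm: "?F \<in> borel_measurable M"
    by (intro sform_measurable borel_measurable_diff UX_measurable smean_measurable)
  have Gm: "?G \<in> borel_measurable M"
    by (intro sform_measurable UX_measurable)
  have sq: "integrable M (\<lambda>x. (f x - c)\<^sup>2)"
    if "f \<in> borel_measurable M" "\<And>x. \<bar>f x\<bar> \<le> b" for f :: "'a \<Rightarrow> real" and b c
  proof (rule integrable_const_bound[of _ "(b + \<bar>c\<bar>)\<^sup>2"])
    have "\<bar>f x - c\<bar> \<le> b + \<bar>c\<bar>" for x using that(2)[of x] by linarith
    hence "(f x - c)\<^sup>2 \<le> (b + \<bar>c\<bar>)\<^sup>2" for x by (metis abs_ge_zero power2_abs power_mono)
    thus "AE x in M. norm ((f x - c)\<^sup>2) \<le> (b + \<bar>c\<bar>)\<^sup>2" by simp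
  qed (use that in simp)
  show "integrable M e" unfolding e_def by (rule sq[OF Fm F])
  have iG: "integrable M (\<lambda>x. (?G x - ?P)\<^sup>2)"
    by (rule sq[OF Gm sform_abs_le[OF n w U_le]])
  have iS: "integrable M (\<lambda>x. (smean n x)\<^sup>2)"
    using sq[OF smean_measurable smean_le[OF n], of 0] by simp
  have "e x \<le> 3 * (?k * (smean n x)\<^sup>2) + 3 * (?G x - ?P)\<^sup>2 + 3 * (Delta cov n)\<^sup>2" for x
  proof -
    have "(a + b + c)\<^sup>2 \<le> 3 * a\<^sup>2 + 3 * b\<^sup>2 + 3 * c\<^sup>2" for a b c :: real
      using zero_le_power2[of "a - b"] zero_le_power2[of "a - c"] zero_le_power2[of "b - c"]
      by (simp add: power2_eq_square algebra_simps)
    from this[of "?F x - ?G x" "?G x - ?P" "?P - ?J"]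
    have "e x \<le> 3 * (?F x - ?G x)\<^sup>2 + 3 * (?G x - ?P)\<^sup>2 + 3 * (?P - ?J)\<^sup>2" by (simp add: e_def)
    moreover have "(?F x - ?G x)\<^sup>2 \<le> (3 * B * row_bound n * \<bar>smean n x\<bar>)\<^sup>2"
      unfolding abs_le_square_iff[symmetric]
      by (rule order_trans[OF centering_error_le[OF n w] abs_ge_self])
    hence "(?F x - ?G x)\<^sup>2 \<le> ?k * (smean n x)\<^sup>2" by (simp add: power_mult_distrib)
    moreover have "(?P - ?J)\<^sup>2 \<le> (Delta cov n)\<^sup>2"
      unfolding abs_le_square_iff[symmetric]
      by (rule order_trans[OF cesaro_spectral_approx[OF sm n] abs_ge_self])
    ultimately show ?thesis by linarith
  qed
  hence "expectation e
    \<le> expectation (\<lambda>x. 3 * (?k * (smean n x)\<^sup>2) + 3 * (?G x - ?P)\<^sup>2 + 3 * (Delta cov n)\<^sup>2)"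
    using \<open>integrable M e\<close> iG iS by (intro integral_mono) auto
  also have "\<dots> = 3 * (?k * expectation (\<lambda>x. (smean n x)\<^sup>2)) + 3 * expectation (\<lambda>x. (?G x - ?P)\<^sup>2)
      + 3 * (Delta cov n)\<^sup>2"
    using iG iS by (simp add: prob_space)
  also have "\<dots> \<le> 3 * (?k * (D * L\<^sup>2 / real n)) +
      3 * (4 * (B\<^sup>2 * (row_bound n)\<^sup>2 * (D * L\<^sup>2 / real n))) + 3 * (Delta cov n)\<^sup>2"
    by (intro add_mono mult_left_mono expectation_smean_squared variance_sform_le n w order_refl) auto
  \<comment> \<open>Here \<open>39 = 3 * 9 + 3 * 4\<close>, from the centering error and the
    variance.\<close>
  also have "\<dots> = 39 * (B\<^sup>2 * (row_bound n)\<^sup>2 * (D * L\<^sup>2 / real n)) + 3 * (Delta cov n)\<^sup>2"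
    by simp
  finally show "expectation e \<le> 39 * (B\<^sup>2 * (row_bound n)\<^sup>2 * (D * L\<^sup>2 / real n)) + 3 * (Delta cov n)\<^sup>2" .
qed

text \<open>An integrable majorant \<open>g\<close>, independent of \<omega>, stands in for the
  supremum, so no measurability of the supremum has to be established. It is built from the
  \<open>N\<close> grid deviations, which explains the factor \<open>N\<close>.\<close>

lemma uniform_deviation:
  assumes n: "n \<ge> 1" and N: "N \<ge> 1"
    and sm: "summable (\<lambda>l. \<bar>cov (l + 1)\<bar> / real (l + 1))"
  obtains g where "integrable M g"
    and "\<And>x \<omega>. 0 \<le> \<omega> \<Longrightarrow> \<omega> \<le> 2 * pi \<Longrightarrow>
      (sform n (\<lambda>j. U (X j x) - smean n x) \<omega> - spectral cov \<omega>)\<^sup>2 \<le> g x"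
    and "expectation g \<le> 2 * (real N * (39 * (B\<^sup>2 * (row_bound n)\<^sup>2 * (D * L\<^sup>2 / real n)) + 3 * (Delta cov n)\<^sup>2))
      + 2 * ((2 * pi + 2) * (cov 1 / real N + Delta cov N))\<^sup>2"
proof -
  define F where "F x = sform n (\<lambda>j. U (X j x) - smean n x)" for x
  define J where "J = spectral cov"
  define t where "t p = 2 * pi * real p / real N" for p
  define d where "d = (2 * pi + 2) * (cov 1 / real N + Delta cov N)"
  define b where "b = 39 * (B\<^sup>2 * (row_bound n)\<^sup>2 * (D * L\<^sup>2 / real n)) + 3 * (Delta cov n)\<^sup>2"
  define S where "S x = (\<Sum>p=1..N. (F x (t p) - J (t p))\<^sup>2)" for x
  have t: "0 \<le> t p" "t p \<le> 2 * pi" if "p \<in> {1..N}" for p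
    using that by (auto simp: t_def divide_le_eq)
  have i: "integrable M (\<lambda>x. (F x (t p) - J (t p))\<^sup>2)"
    and e: "expectation (\<lambda>x. (F x (t p) - J (t p))\<^sup>2) \<le> b" if "p \<in> {1..N}" for p
    using pointwise_deviation[OF n t[OF that] sm] unfolding F_def J_def b_def .
  have cov_1_nonneg: "0 \<le> cov 1"
    by (rule Bochner_Integration.integral_nonneg) simp
  have iS: "integrable M S"
    unfolding S_def by (intro Bochner_Integration.integrable_sum i)
  have "expectation S = (\<Sum>p=1..N. expectation (\<lambda>x. (F x (t p) - J (t p))\<^sup>2))"
    unfolding S_def by (intro Bochner_Integration.integral_sum i)
  also have "\<dots> \<le> real N * b"
    using sum_bounded_above[OF e, of "{1..N}"] by simp
  finally have eS: "expectation S \<le> real N * b" .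
  show thesis
  proof (rule that)
    show "integrable M (\<lambda>x. 2 * S x + 2 * d\<^sup>2)"
      using iS by simp
    show "expectation (\<lambda>x. 2 * S x + 2 * d\<^sup>2) \<le> 2 * (real N *
        (39 * (B\<^sup>2 * (row_bound n)\<^sup>2 * (D * L\<^sup>2 / real n)) + 3 * (Delta cov n)\<^sup>2))
      + 2 * ((2 * pi + 2) * (cov 1 / real N + Delta cov N))\<^sup>2"
      using iS eS unfolding b_def[symmetric] d_def[symmetric] by (simp add: prob_space)
    show "(sform n (\<lambda>j. U (X j x) - smean n x) \<omega> - spectral cov \<omega>)\<^sup>2 \<le> 2 * S x + 2 * d\<^sup>2"
      if "0 \<le> \<omega>" "\<omega> \<le> 2 * pi" for x \<omega>
      unfolding F_def[symmetric] J_def[symmetric] S_def t_def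
    proof (rule grid_deviation_le[OF _ _ N _ _ that])
      have "dkernel 0 j l = 0" for j l by (simp add: dkernel_def)
      thus "F x 0 = J 0" by (simp add: F_def J_def sform_def spectral_def)
      show "\<bar>J y - J z\<bar> \<le> d" if "\<bar>y - z\<bar> \<le> 2 * pi / real N" for y z
        unfolding J_def d_def by (rule spectral_oscillation[OF sm N cov_1_nonneg that])
      show "F x y \<le> F x z" if "0 \<le> y" "y \<le> z" for y z
        unfolding F_def by (rule sform_mono[OF that])
    qed simp
  qed
qed

end

section \<open>Return to the original observable and the final bound\<close>

lemma hoelder_le:
  assumes "hoelder \<eta> u"
  shows "\<bar>u x - u y\<bar> \<le> hoelder_const \<eta> u * norm (x - y) powr \<eta>"
proof (cases "x = y")
  case False
  hence "\<bar>u x - u y\<bar> / norm (x - y) powr \<eta> \<le> hoelder_const \<eta> u"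
    unfolding hoelder_const_def using assms
    by (intro cSup_upper) (auto simp: hoelder_def hoelder_quotients_def)
  thus ?thesis using False by (simp add: divide_le_eq)
qed simp

text \<open>Used to turn a bound on the distance between two values of the observable into one on
  the distance from its mean.\<close>

lemma (in prob_space) abs_diff_expectation_le:
  fixes f g :: "'a \<Rightarrow> real"
  assumes "integrable M g" "AE y in M. \<bar>z - g y\<bar> \<le> c"
  shows "\<bar>z - expectation g\<bar> \<le> c"
proof -
  have "AE y in M. z - c \<le> g y" "AE y in M. g y \<le> z + c"
    using assms(2) by (auto elim!: eventually_mono)
  hence "z - c \<le> expectation g" "expectation g \<le> z + c"
    using assms(1) by (auto intro: integral_ge_const integral_le_const)
  thus ?thesis by linarith
qed

text \<open>Empirical centering cancels any constant \<open>m\<close>, so the true mean may be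
  subtracted beforehand.\<close>

lemma emp_spectral_eq_sform:
  assumes "0 \<le> \<omega>" and "\<And>j. j \<in> {1..n} \<Longrightarrow> v j = u (X j x) - m"
  shows "emp_spectral X u n x \<omega> = sform n (\<lambda>j. v j - 1 / real n * (\<Sum>l=1..n. v l)) \<omega>"
proof -
  have "v j - 1 / real n * (\<Sum>l=1..n. v l) = u (X j x) - 1 / real n * (\<Sum>l=1..n. u (X l x))"
    if "j \<in> {1..n}" for j
    using that assms(2) by (simp add: sum_subtractf right_diff_distrib)
  hence "sform n (\<lambda>j. v j - 1 / real n * (\<Sum>l=1..n. v l)) \<omega>
     = sform n (\<lambda>j. u (X j x) - 1 / real n * (\<Sum>l=1..n. u (X l x))) \<omega>"
    by (simp add: sform_def)
  thus ?thesis
    unfolding emp_spectral_def by (simp only: integral_periodogram[OF assms(1)])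
qed

text \<open>The pointwise bound also makes the set bounded above, so the real-valued supremum is the
  genuine one.\<close>

lemma cSup_squared_le:
  fixes f :: "real \<Rightarrow> real"
  assumes "S \<noteq> {}" and f: "\<And>w. w \<in> S \<Longrightarrow> (f w)\<^sup>2 \<le> b"
  shows "(SUP w\<in>S. \<bar>f w\<bar>)\<^sup>2 \<le> b"
proof -
  have le: "\<bar>f w\<bar> \<le> sqrt b" if "w \<in> S" for w
    using f[OF that] by (metis real_sqrt_abs real_sqrt_le_mono)
  obtain w where w: "w \<in> S" using assms(1) by auto
  have "0 \<le> (SUP w\<in>S. \<bar>f w\<bar>)"
    by (rule cSUP_upper2[OF _ w]) (auto intro!: bdd_aboveI[of _ "sqrt b"] le)
  moreover have "(SUP w\<in>S. \<bar>f w\<bar>) \<le> sqrt b"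
    by (intro cSUP_least assms(1) le)
  ultimately have "(SUP w\<in>S. \<bar>f w\<bar>)\<^sup>2 \<le> (sqrt b)\<^sup>2" by (intro power_mono)
  moreover have "0 \<le> b" using f[OF w] by (meson order_trans zero_le_power2)
  ultimately show ?thesis by simp
qed

text \<open>The factor 4 bounds \<open>(2 powr \<eta>)\<^sup>2\<close>, by
  \<open>\<eta> \<le> 1\<close>. The fourth power of \<open>L\<close> joins the square from the
  bound on the observable to the one from the Devroye inequality.\<close>

lemma deviation_constants_le:
  fixes A L D \<eta> :: real
  assumes "0 < A" "0 < \<eta>" "\<eta> \<le> 1" "0 < D" "n \<ge> 1"
  shows "(L * (2 * A) powr \<eta>)\<^sup>2 * (row_bound n)\<^sup>2 * (D * L\<^sup>2 / real n)
    \<le> 4 * (2 * pi + 2)\<^sup>2 * (D * A powr (2 * \<eta>) * L ^ 4 * (1 + ln (real n))\<^sup>2 / real n)"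
proof -
  have "((2 :: real) powr \<eta>)\<^sup>2 \<le> 2\<^sup>2"
    using assms powr_mono[of \<eta> 1 "2 :: real"] by (intro power_mono) auto
  hence p: "((2 :: real) powr \<eta>)\<^sup>2 \<le> 4" by simp
  have "(A powr \<eta>)\<^sup>2 = A powr (2 * \<eta>)"
    by (simp add: power2_eq_square flip: powr_add)
  hence "(L * (2 * A) powr \<eta>)\<^sup>2 * (row_bound n)\<^sup>2 * (D * L\<^sup>2 / real n)
    = (2 powr \<eta>)\<^sup>2 * ((2 * pi + 2)\<^sup>2 * (D * A powr (2 * \<eta>) * L ^ 4 * (1 + ln (real n))\<^sup>2 / real n))"
    using assms by (simp add: row_bound_def powr_mult power_mult_distrib power4_eq_xxxx power2_eq_square[of L])
  also have "\<dots> \<le> 4 * ((2 * pi + 2)\<^sup>2 * (D * A powr (2 * \<eta>) * L ^ 4 * (1 + ln (real n))\<^sup>2 / real n))"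
    using assms by (intro mult_right_mono p mult_nonneg_nonneg divide_nonneg_nonneg) auto
  finally show ?thesis by (simp only: mult.assoc)
qed

theorem theorem3p1:
  fixes M :: "'a measure" and X :: "nat \<Rightarrow> 'a \<Rightarrow> real ^ 'd" and A \<eta> D :: real
  assumes "prob_space M"
    and "A > 0"
    and "\<And>k. k \<ge> 1 \<Longrightarrow> X k \<in> borel_measurable M"
    and "stationary M X" and "ergodic M X"
    and "\<And>k. k \<ge> 1 \<Longrightarrow> AE x in M. norm (X k x) \<le> A"
    and "devroye_inequality M X"
    and "0 < \<eta>" and "\<eta> \<le> 1"
    and "devroye_const M X \<eta> D"
  shows "\<exists>\<Gamma>>0. \<forall>u :: real ^ 'd \<Rightarrow> real. \<forall>C L.
    hoelder \<eta> u \<longrightarrow> L = hoelder_const \<eta> u \<longrightarrow> C = autocov M X u \<longrightarrow>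
    summable (\<lambda>l. \<bar>C (l + 1)\<bar> / real (l + 1)) \<longrightarrow>
    (\<forall>n\<ge>1.
      prob_space.expectation M
        (\<lambda>x. (SUP \<omega>\<in>{0..2 * pi}. \<bar>emp_spectral X u n x \<omega> - spectral C \<omega>\<bar>)\<^sup>2)
      \<le> \<Gamma> * (INF N\<in>{1..}.
          real N * (((C 1)\<^sup>2 + D * A powr (2 * \<eta>) * L ^ 4 * (1 + ln (real n))\<^sup>2) / real n
                    + (Delta C n)\<^sup>2)
          + (C 1 / real N + Delta C N)\<^sup>2))"
proof -
  interpret prob_space M by fact
  note X_meas = assms(3) and stat = assms(4) and bounded = assms(6)
  define \<kappa> :: real where "\<kappa> = (2 * pi + 2)\<^sup>2"
  have "1\<^sup>2 \<le> \<kappa>" unfolding \<kappa>_def by (intro power_mono) auto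
  hence \<kappa>: "1 \<le> \<kappa>" by simp
  show ?thesis
  \<comment> \<open>The constant is \<open>312 = 2 * 39 * 4\<close>: the grid lemma, the pointwise
    deviation and the bound on \<open>(2 powr \<eta>)\<^sup>2\<close>.\<close>
  proof (intro exI[of _ "312 * \<kappa>"] conjI allI impI)
    fix u :: "real ^ 'd \<Rightarrow> real" and C L n
    assume hoelder: "hoelder \<eta> u" and L: "L = hoelder_const \<eta> u" and C: "C = autocov M X u"
      and sm: "summable (\<lambda>l. \<bar>C (l + 1)\<bar> / real (l + 1))" and n: "n \<ge> (1 :: nat)"
    \<comment> \<open>Points of the ball of radius \<open>A\<close> are at most \<open>2 * A\<close>
      apart, so \<open>B\<close> bounds the oscillation of \<open>u\<close> there, hence almost
      surely its distance from the mean \<open>m\<close>.\<close>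
    define B where "B = L * (2 * A) powr \<eta>"
    define m where "m = expectation (\<lambda>x. u (X 1 x))"
    text \<open>The Devroye inequality only applies to functions that are separately Hoelder on the whole
      space, so the quadratic form has to be made globally so by clipping the observable.\<close>
    define U where "U z = max (- B) (min B (u z - m))" for z
    have hu: "\<bar>u x - u y\<bar> \<le> L * norm (x - y) powr \<eta>" for x y
      unfolding L by (rule hoelder_le[OF hoelder])
    have "(0 :: real ^ 'd) \<noteq> 1" by (simp add: vec_eq_iff)
    hence "0 < norm (0 - 1 :: real ^ 'd) powr \<eta>" by simp
    hence L0: "0 \<le> L"
      using order_trans[OF abs_ge_zero hu[of 0 1]] by (simp only: zero_le_mult_iff) auto
    have u_meas: "u \<in> borel_measurable borel"
      by (rule borel_measurable_hoelder[OF assms(8) hu])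
    have uX_meas: "(\<lambda>x. u (X k x)) \<in> borel_measurable M" if "k \<ge> 1" for k
      using measurable_compose[OF X_meas[OF that] u_meas] .
    have close: "\<bar>u y - u z\<bar> \<le> B" if "norm y \<le> A" "norm z \<le> A" for y z
    proof -
      have "norm (y - z) powr \<eta> \<le> (2 * A) powr \<eta>"
        using norm_triangle_ineq4[of y z] that assms(8) by (intro powr_mono2) auto
      thus ?thesis
        unfolding B_def by (rule order_trans[OF hu mult_left_mono]) (rule L0)
    qed
    have uX_int: "integrable M (\<lambda>x. u (X k x))" if k: "k \<ge> 1" for k
    proof (rule integrable_const_bound[OF _ uX_meas[OF k]])
      show "AE x in M. norm (u (X k x)) \<le> \<bar>u 0\<bar> + B"
        using bounded[OF k]
      proof eventually_elim
        case (elim x)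
        thus ?case using close[of "X k x" 0] assms(2) by auto
      qed
    qed
    have B0: "0 \<le> B" using L0 by (simp add: B_def)
    have U_eq: "AE x in M. U (X k x) = u (X k x) - m" if k: "k \<ge> 1" for k
      using bounded[OF k]
    proof eventually_elim
      case (elim x)
      have "AE y in M. \<bar>u (X k x) - u (X 1 y)\<bar> \<le> B"
        using bounded[OF order_refl] by eventually_elim (rule close[OF elim])
      hence "\<bar>u (X k x) - m\<bar> \<le> B"
        unfolding m_def by (intro abs_diff_expectation_le uX_int) auto
      thus ?case by (auto simp: U_def)
    qed
    have hU: "\<bar>U x - U y\<bar> \<le> L * norm (x - y) powr \<eta>" for x y
    proof -
      \<comment> \<open>Clipping to an interval does not increase distances, so the Hoelder constant
        survives.\<close>
      have "\<bar>U x - U y\<bar> \<le> \<bar>u x - u y\<bar>" unfolding U_def by (auto simp: max_def min_def)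
      thus ?thesis using hu order_trans by blast
    qed
    have U_meas: "U \<in> borel_measurable borel"
      by (rule borel_measurable_hoelder[OF assms(8) hU])
    have UX_meas: "(\<lambda>x. U (X k x)) \<in> borel_measurable M" if "k \<ge> 1" for k
      using measurable_compose[OF X_meas[OF that] U_meas] .
    have "expectation (\<lambda>x. U (X 1 x)) = expectation (\<lambda>x. u (X 1 x) - m)"
      by (intro integral_cong_AE U_eq borel_measurable_diff UX_meas uX_meas) auto
    also have "\<dots> = 0" using uX_int by (simp add: m_def prob_space)
    finally have mean_U: "expectation (\<lambda>x. U (X 1 x)) = 0" .
    interpret centered_observable M X U \<eta> D B L
      using X_meas stat assms(8,10) hU mean_U B0 by unfold_locales (auto simp: U_def)
    have uX_mean: "expectation (\<lambda>x. u (X k x)) = m" if "k \<ge> 1" for k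
      using stationary_expectation_pair[OF X_meas stat u_meas, of "\<lambda>_. 1" 1 1 "k - 1"] that
      by (simp add: m_def)
    \<comment> \<open>The values at 0 may differ, since \<open>X 0\<close> is unconstrained;
      \<open>spectral\<close> and \<open>Delta\<close> evaluate their argument only from 1
      on.\<close>
    have cov_eq: "cov k = C k" if k: "k \<ge> 1" for k
    proof -
      have "AE x in M. u (X 1 x) * u (X k x) = U (X 1 x) * U (X k x) + m * u (X 1 x) + m * u (X k x) - m\<^sup>2"
        using U_eq[OF order_refl] U_eq[OF k]
        by eventually_elim (simp only: power2_eq_square, simp add: algebra_simps)
      hence "expectation (\<lambda>x. u (X 1 x) * u (X k x))
        = expectation (\<lambda>x. U (X 1 x) * U (X k x) + m * u (X 1 x) + m * u (X k x) - m\<^sup>2)"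
        using k by (intro integral_cong_AE borel_measurable_diff borel_measurable_add borel_measurable_times
            uX_meas UX_meas) auto
      also have "\<dots> = cov k + m * m + m * m - m\<^sup>2"
        using k by (simp add: UX_mult_integrable uX_int uX_mean prob_space)
      finally show ?thesis using k by (simp add: C autocov_def uX_mean power2_eq_square)
    qed
    have cov_Suc: "cov (k + 1) = C (k + 1)" and cov_1: "cov 1 = C 1" for k
      by (rule cov_eq, simp)+
    have smc: "summable (\<lambda>l. \<bar>cov (l + 1)\<bar> / real (l + 1))"
      using sm by (simp only: cov_Suc)
    have J_eq: "spectral cov = spectral C" and Delta_eq: "Delta cov = Delta C"
      by (intro ext, simp only: spectral_def Delta_def cov_Suc cov_1)+
    let ?f = "\<lambda>x. (SUP \<omega>\<in>{0..2 * pi}. \<bar>emp_spectral X u n x \<omega> - spectral C \<omega>\<bar>)\<^sup>2"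
    let ?W = "D * A powr (2 * \<eta>) * L ^ 4 * (1 + ln (real n))\<^sup>2"
    let ?h = "\<lambda>N. real N * (((C 1)\<^sup>2 + ?W) / real n + (Delta C n)\<^sup>2) + (C 1 / real N + Delta C N)\<^sup>2"
    have main: "expectation ?f \<le> 312 * \<kappa> * ?h N" if N: "N \<ge> 1" for N
    proof -
      obtain g where g: "integrable M g"
        and g_ge: "\<And>x \<omega>. 0 \<le> \<omega> \<Longrightarrow> \<omega> \<le> 2 * pi \<Longrightarrow>
          (sform n (\<lambda>j. U (X j x) - smean n x) \<omega> - spectral C \<omega>)\<^sup>2 \<le> g x"
        and Eg: "expectation g \<le> 2 * (real N * (39 * (B\<^sup>2 * (row_bound n)\<^sup>2 * (D * L\<^sup>2 / real n))
          + 3 * (Delta C n)\<^sup>2)) + 2 * ((2 * pi + 2) * (C 1 / real N + Delta C N))\<^sup>2"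
        using uniform_deviation[OF n N smc] unfolding J_eq Delta_eq cov_1 by blast
      have "AE x in M. \<forall>k\<in>{1..n}. U (X k x) = u (X k x) - m"
        by (intro AE_finite_allI U_eq) auto
      hence "AE x in M. ?f x \<le> g x"
      proof eventually_elim
        case (elim x)
        have "emp_spectral X u n x \<omega> = sform n (\<lambda>j. U (X j x) - smean n x) \<omega>" if "0 \<le> \<omega>" for \<omega>
          unfolding smean_def using elim by (intro emp_spectral_eq_sform[OF that]) auto
        thus ?case using g_ge by (intro cSup_squared_le) auto
      qed
      \<comment> \<open>Should the squared supremum fail to be integrable, its expectation is 0 by
        convention, and nonnegativity of \<open>g\<close> still gives the comparison.\<close>
      moreover have "g x \<ge> 0" for x
        using order_trans[OF zero_le_power2 g_ge[of 0 x]] by simp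
      ultimately have "expectation ?f \<le> expectation g"
        by (intro integral_mono_AE' g) auto
      also have "\<dots> \<le> 2 * (real N * (39 * (4 * \<kappa> * (?W / real n)) + 3 * (Delta C n)\<^sup>2))
          + 2 * (\<kappa> * (C 1 / real N + Delta C N)\<^sup>2)"
      proof (rule order_trans[OF Eg], intro add_mono mult_left_mono)
        show "B\<^sup>2 * (row_bound n)\<^sup>2 * (D * L\<^sup>2 / real n) \<le> 4 * \<kappa> * (?W / real n)"
          unfolding B_def \<kappa>_def by (rule deviation_constants_le[OF assms(2,8,9) D_pos n])
      qed (auto simp: \<kappa>_def power_mult_distrib)
      also have "\<dots> = real N * (312 * \<kappa> * (?W / real n) + 6 * (Delta C n)\<^sup>2)
          + 2 * \<kappa> * (C 1 / real N + Delta C N)\<^sup>2"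
        by (simp add: algebra_simps)
      \<comment> \<open>All coefficients are raised to \<open>312 * \<kappa>\<close> by
        \<open>1 \<le> \<kappa>\<close>, and the nonnegative \<open>(C 1)\<^sup>2\<close> is
        added.\<close>
      also have "\<dots> \<le> real N * (312 * \<kappa> * (((C 1)\<^sup>2 + ?W) / real n) + 312 * \<kappa> * (Delta C n)\<^sup>2)
          + 312 * \<kappa> * (C 1 / real N + Delta C N)\<^sup>2"
        using \<kappa> by (intro add_mono mult_left_mono mult_right_mono divide_right_mono) auto
      also have "\<dots> = 312 * \<kappa> * ?h N"
        by (simp only: distrib_left mult.left_commute mult.assoc)
      finally show ?thesis .
    qed
    \<comment> \<open>The positive constant is moved to the left so that the bounds for all
      \<open>N\<close> pass to the infimum.\<close>
    have "expectation ?f / (312 * \<kappa>) \<le> (INF N\<in>{1..}. ?h N)"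
    proof (rule cINF_greatest)
      fix N :: nat assume "N \<in> {1..}"
      thus "expectation ?f / (312 * \<kappa>) \<le> ?h N"
        using main[of N] \<kappa> by (simp add: divide_le_eq mult.commute)
    qed auto
    thus "expectation ?f \<le> 312 * \<kappa> * (INF N\<in>{1..}. ?h N)"
      using \<kappa> by (simp add: divide_le_eq mult.commute)
  qed (use \<kappa> in simp)
qed

end
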